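(* Let $k$ be an algebraically closed and uncountable field, let $n$ be a positive integer, and let $I\subsetneq k[T_1,\ldots,T_n]_{\mathbb{Q}}$ be a proper ideal. Then $V(I)$ is non-empty.
   Context: The ring of polynomials with rational degree is $k[T_1,\ldots,T_n]_{\mathbb{Q}}=\bigcup_{i\ge 1} k[T_1,T_1^{1/2},\ldots,T_1^{1/i},\ldots,T_n,T_n^{1/2},\ldots,T_n^{1/i}]$, where the $T_j^{1/i}$ are formally adjoined compatible roots of $T_j$; equivalently, its elements are finite $k$-linear combinations of monomials $T_1^{r_1}\cdots T_n^{r_n}$ with $r_j\in\mathbb{Q}_{\ge 0}$, with exponents adding under multiplication. For a subset $S$ of this ring, $V(S)\subseteq k^n$ is the set of common zeros of all elements of $S$: $V(S)=\{x\in k^n : F(x)=0 \text{ for all } F\in S\}$. Convention on evaluation: evaluating at $x=(x_1,\ldots,x_n)\in k^n$ requires values for the fractional powers $x_j^{1/i}$. A point $x$ belongs to $V(S)$ if there are elements $x_j^{1/i}\in k$ ($1\le j\le n$, $i\in\mathbb{Z}_{>0}$) with $x_j^{1/1}=x_j$ and $(x_j^{1/(il)})^{l}=x_j^{1/i}$ for all $i,l\in\mathbb{Z}_{>0}$, such that every $F\in S$ becomes $0$ after substituting $T_j^{1/i}\mapsto x_j^{1/i}$ for all $j$ and $i$. *)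

theory Defs
  imports
    "HOL-Analysis.Finite_Cartesian_Product"
    "HOL-Library.Countable_Set"
    "HOL-Library.Poly_Mapping"
    "HOL-Computational_Algebra.Polynomial"
    "HOL-Algebra.Ideal"
begin

text \<open>
  The index type \<open>'n\<close> has the \<open>n\<close> variables as its elements.  A polynomial with rational degree
  is a finitely supported family of coefficients, indexed by exponent vectors whose entries are
  all nonnegative; the multiplication of \<open>\<Rightarrow>\<^sub>0\<close> is convolution, so exponents add.
\<close>

definition rat_poly_ring :: "((rat ^ 'n) \<Rightarrow>\<^sub>0 'k::field) ring" where
  "rat_poly_ring =
     \<lparr>carrier = {F. \<forall>r \<in> Poly_Mapping.keys F. \<forall>j. 0 \<le> r $ j},
      mult = (*), one = 1, zero = 0, add = (+)\<rparr>"

lemma cring_rat_poly_ring: "cring (rat_poly_ring :: ((rat ^ 'n) \<Rightarrow>\<^sub>0 'k::field) ring)"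
proof -
  let ?R = "rat_poly_ring :: ((rat ^ 'n) \<Rightarrow>\<^sub>0 'k) ring"
  have add: "F + G \<in> carrier ?R" if "F \<in> carrier ?R" "G \<in> carrier ?R" for F G
    using that Poly_Mapping.keys_add[of F G] by (fastforce simp: rat_poly_ring_def)
  have mult: "F * G \<in> carrier ?R" if "F \<in> carrier ?R" "G \<in> carrier ?R" for F G
    using that Poly_Mapping.keys_mult[of F G] by (fastforce simp: rat_poly_ring_def)
  have simps: "x \<oplus>\<^bsub>?R\<^esub> y = x + y" "x \<otimes>\<^bsub>?R\<^esub> y = x * y" "\<zero>\<^bsub>?R\<^esub> = 0" "\<one>\<^bsub>?R\<^esub> = 1" for x y
    by (simp_all add: rat_poly_ring_def)
  have zero: "0 \<in> carrier ?R" and one: "1 \<in> carrier ?R"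
    by (simp_all add: rat_poly_ring_def)
  have uminus: "- F \<in> carrier ?R" if "F \<in> carrier ?R" for F
    using that by (simp add: rat_poly_ring_def Poly_Mapping.keys_def)
  have "abelian_group ?R"
    by (rule abelian_groupI; unfold simps)
      (use uminus in \<open>auto simp: add zero ac_simps intro!: bexI[of _ "- F" for F]\<close>)
  moreover have "comm_monoid ?R"
    by (rule comm_monoidI; unfold simps) (simp_all add: mult one ac_simps)
  ultimately show ?thesis
    by (rule cringI; unfold simps) (rule distrib_right)
qed

text \<open>
  \<open>\<rho> j i\<close> is the chosen value of \<open>x_j^(1/i)\<close>, for \<open>i > 0\<close>; the value \<open>\<rho> j 0\<close> is never used.
\<close>

definition compatible_roots :: "('k::field) ^ 'n \<Rightarrow> ('n \<Rightarrow> nat \<Rightarrow> 'k) \<Rightarrow> bool" where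
  "compatible_roots x \<rho> \<longleftrightarrow>
     (\<forall>j. \<rho> j 1 = x $ j) \<and>
     (\<forall>j i l. 0 < i \<longrightarrow> 0 < l \<longrightarrow> \<rho> j (i * l) ^ l = \<rho> j i)"

text \<open>
  The value of \<open>T_j^r\<close> for \<open>r = a / b\<close> in lowest terms.  For compatible roots and \<open>r \<ge> 0\<close> any other
  fraction representing \<open>r\<close> gives the same value, as \<open>root_power_eq\<close> shows.
\<close>

definition root_power :: "(nat \<Rightarrow> 'k::field) \<Rightarrow> rat \<Rightarrow> 'k" where
  "root_power s r = (case quotient_of r of (a, b) \<Rightarrow> s (nat b) ^ nat a)"

lemma root_power_eq:
  assumes "compatible_roots x \<rho>" "0 < i"
  shows "root_power (\<rho> j) (of_nat m / of_nat i) = \<rho> j i ^ m"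
proof -
  obtain a b where q: "quotient_of (of_nat m / of_nat i) = (a, b)"
    by (cases "quotient_of (of_nat m / of_nat i)")
  have b: "b > 0" and eq: "of_nat m / of_nat i = (of_int a / of_int b :: rat)"
    using quotient_of_denom_pos[OF q] quotient_of_div[OF q] by auto
  have a: "a \<ge> 0"
  proof -
    have "(of_int a / of_int b :: rat) \<ge> 0" unfolding eq[symmetric] by simp
    then show ?thesis using b by (simp add: zero_le_divide_iff)
  qed
  have "(of_int (int m * b) :: rat) = of_int (a * int i)"
    using eq b assms(2) by (simp add: field_simps)
  then have "int m * b = a * int i" by (simp only: of_int_eq_iff)
  then have "int (m * nat b) = int (nat a * i)" using a b by simp
  then have mi: "m * nat b = nat a * i" by (simp only: of_nat_eq_iff)
  have b': "0 < nat b" using b by simp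
  have r: "\<rho> j (u * l) ^ l = \<rho> j u" if "0 < u" "0 < l" for u l
    using assms(1) that by (auto simp: compatible_roots_def)
  have "\<rho> j (nat b) ^ nat a = \<rho> j (nat b * i) ^ (nat a * i)"
    using r[OF b' assms(2)] by (metis power_mult mult.commute)
  also have "\<dots> = \<rho> j (i * nat b) ^ (nat b * m)"
    using mi by (simp add: mult.commute)
  also have "\<dots> = \<rho> j i ^ m"
    using r[OF assms(2) b'] by (simp add: power_mult)
  finally show ?thesis by (simp add: root_power_def q)
qed

definition eval_rat_poly ::
    "('n::finite \<Rightarrow> nat \<Rightarrow> 'k::field) \<Rightarrow> ((rat ^ 'n) \<Rightarrow>\<^sub>0 'k) \<Rightarrow> 'k" where
  "eval_rat_poly \<rho> F =
     (\<Sum>r \<in> Poly_Mapping.keys F. Poly_Mapping.lookup F r * (\<Prod>j \<in> UNIV. root_power (\<rho> j) (r $ j)))"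

text \<open>
  The roots are chosen once for each point: the same \<open>\<rho>\<close> has to work for all \<open>F \<in> S\<close>.
\<close>

definition zero_locus :: "((rat ^ 'n) \<Rightarrow>\<^sub>0 'k::field) set \<Rightarrow> ('k ^ 'n::finite) set" where
  "zero_locus S = {x. \<exists>\<rho>. compatible_roots x \<rho> \<and> (\<forall>F \<in> S. eval_rat_poly \<rho> F = 0)}"

end

theory Submission
  imports Defs
begin

text \<open>
  Enlarge the ideal to a maximal ideal \<open>M\<close>.  Every \<open>F\<close> is congruent to a constant modulo \<open>M\<close>:
  otherwise each \<open>F - c\<close> has an inverse \<open>G c\<close> modulo \<open>M\<close>.  There are uncountably many \<open>c\<close> but only
  countably many finite sets of exponents, so infinitely many of the \<open>G c\<close> have the same support
  and hence satisfy a linear relation.  Clearing denominators gives a nonzero polynomial \<open>p\<close> over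
  \<open>k\<close> with \<open>p(F) \<in> M\<close>; as \<open>p\<close> splits and \<open>M\<close> is prime, some \<open>F - c\<close> lies in \<open>M\<close> after all.  So
  the quotient is \<open>k\<close>, and the images of the \<open>T_j^(1/i)\<close> are compatible roots of a common zero.
\<close>

section \<open>Maximal ideals in commutative rings\<close>

text \<open>Zorn's lemma: the union of a chain of ideals is an ideal, since any two of its elements
  already lie in a common member.\<close>

lemma (in cring) proper_ideal_subset_maximalideal:
  assumes "ideal I R" "I \<noteq> carrier R"
  obtains M where "maximalideal M R" "I \<subseteq> M"
proof -
  \<comment> \<open>Properness is expressed as \<open>\<one> \<notin> J\<close>, a condition that
    visibly survives unions.\<close>
  define \<A> where "\<A> = {J. ideal J R \<and> I \<subseteq> J \<and> \<one> \<notin> J}"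
  have "I \<in> \<A>"
    using assms ideal.one_imp_carrier by (auto simp: \<A>_def)
  have "\<Union>\<C> \<in> \<A>" if ne: "\<C> \<noteq> {}" and ch: "subset.chain \<A> \<C>" for \<C>
  proof -
    have sub: "\<C> \<subseteq> \<A>" and tot: "\<And>X Y. X \<in> \<C> \<Longrightarrow> Y \<in> \<C> \<Longrightarrow> X \<subseteq> Y \<or> Y \<subseteq> X"
      using ch by (auto simp: subset_chain_def)
    have id: "ideal J R" if "J \<in> \<C>" for J
      using sub that by (auto simp: \<A>_def)
    have "ideal (\<Union>\<C>) R"
    proof (rule idealI[OF ring_axioms])
      show "subgroup (\<Union>\<C>) (add_monoid R)"
      proof (rule add.subgroupI)
        show "\<Union>\<C> \<subseteq> carrier R"
          using id ideal.Icarr by fastforce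
        show "\<Union>\<C> \<noteq> {}"
          using ne id additive_subgroup.zero_closed ideal.axioms(1) by fastforce
        show "\<ominus> a \<in> \<Union>\<C>" if "a \<in> \<Union>\<C>" for a
          using that id additive_subgroup.a_inv_closed ideal.axioms(1) by fastforce
        show "a \<oplus> b \<in> \<Union>\<C>" if ab: "a \<in> \<Union>\<C>" "b \<in> \<Union>\<C>" for a b
        proof -
          obtain X Y where "X \<in> \<C>" "a \<in> X" "Y \<in> \<C>" "b \<in> Y"
            using ab by blast
          then obtain J where J: "J \<in> \<C>" "a \<in> J" "b \<in> J"
            using tot[of X Y] by blast
          then have "a \<oplus> b \<in> J"
            by (intro additive_subgroup.a_closed ideal.axioms(1) id)
          then show ?thesis
            using J(1) by blast
        qed
      qed
    qed (use id ideal.I_l_closed ideal.I_r_closed in fastforce)+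
    then show ?thesis
      using ne sub by (auto simp: \<A>_def)
  qed
  then obtain M where M: "M \<in> \<A>" and max: "\<And>X. X \<in> \<A> \<Longrightarrow> M \<subseteq> X \<Longrightarrow> X = M"
    using subset_Zorn_nonempty[of \<A>] \<open>I \<in> \<A>\<close> by blast
  have "maximalideal M R"
  proof (rule maximalidealI)
    show "ideal M R" "carrier R \<noteq> M"
      using M by (auto simp: \<A>_def)
    show "J = M \<or> J = carrier R" if "ideal J R" "M \<subseteq> J" for J
      using that M max[of J] ideal.one_imp_carrier by (auto simp: \<A>_def)
  qed
  then show thesis
    using M that by (auto simp: \<A>_def)
qed

text \<open>The ideal \<open>M + (f)\<close> is strictly larger than \<open>M\<close>, so it is the
  whole ring and contains \<open>\<one>\<close>.\<close>

lemma (in cring) maximalideal_inverse_mod: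
  assumes "maximalideal M R" "f \<in> carrier R" "f \<notin> M"
  shows "\<exists>g \<in> carrier R. \<exists>m \<in> M. m \<oplus> g \<otimes> f = \<one>"
proof -
  interpret M: maximalideal M R by fact
  let ?J = "set_add R M (PIdl f)"
  interpret P: ideal "PIdl f" R
    by (rule cgenideal_ideal[OF assms(2)])
  have id: "ideal ?J R"
    by (intro add_ideals M.is_ideal P.is_ideal)
  have mem: "m \<oplus> x \<in> ?J" if "m \<in> M" "x \<in> PIdl f" for m x
    using that unfolding set_add_def' by blast
  have "f \<in> ?J"
    using mem[OF M.zero_closed cgenideal_self[OF assms(2)]] assms(2) by simp
  moreover have "M \<subseteq> ?J"
    using mem[OF _ P.zero_closed] M.Icarr by fastforce
  moreover have "?J \<subseteq> carrier R"
    using ideal.Icarr[OF id] by blast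
  ultimately have "?J = carrier R"
    using M.I_maximal[OF id] assms(3) by blast
  then have "\<one> \<in> ?J" by simp
  then show ?thesis
    unfolding set_add_def' cgenideal_def by force
qed

section \<open>Linear relations in uncountable families\<close>

text \<open>Gaussian elimination: with more unknowns than equations, each induction step uses one
  unknown as a pivot to remove one equation.\<close>

lemma exists_linear_relation:
  fixes G :: "'a \<Rightarrow> 'b \<Rightarrow> 'k::field"
  assumes "finite S" "finite A" "card S < card A"
  shows "\<exists>\<mu>. (\<exists>a \<in> A. \<mu> a \<noteq> 0) \<and> (\<forall>s \<in> S. (\<Sum>a \<in> A. \<mu> a * G a s) = 0)"
  using assms
proof (induction S arbitrary: A G rule: finite_induct)
  case empty
  then show ?case by (intro exI[of _ "\<lambda>_. 1"]) (auto simp: card_gt_0_iff)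
next
  case (insert s S)
  show ?case
  proof (cases "\<forall>a \<in> A. G a s = 0")
    case True
    have "card S < card A" using insert.prems insert.hyps by simp
    from insert.IH[OF insert.prems(1) this, of G] True show ?thesis by auto
  next
    case False
    then obtain c where c: "c \<in> A" "G c s \<noteq> 0" by blast
    let ?B = "A - {c}"
    \<comment> \<open>Subtracting a multiple of the pivot \<open>G c\<close> makes coordinate
      \<open>s\<close> vanish.\<close>
    let ?H = "\<lambda>a t. G a t - G a s / G c s * G c t"
    have "card S < card ?B" "finite ?B"
      using insert c by (auto simp: card_Diff_singleton)
    from insert.IH[OF this(2,1), of ?H]
    obtain \<mu> a where a: "a \<in> ?B" "\<mu> a \<noteq> 0"
      and \<mu>: "\<And>t. t \<in> S \<Longrightarrow> (\<Sum>a \<in> ?B. \<mu> a * ?H a t) = 0" by blast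
    \<comment> \<open>The coefficient of the pivot, obtained by solving the equation at
      \<open>s\<close>.\<close>
    define v where "v = - (\<Sum>a \<in> ?B. \<mu> a * G a s) / G c s"
    let ?\<nu> = "\<mu>(c := v)"
    have "(\<Sum>a \<in> A. ?\<nu> a * G a t) = (\<Sum>a \<in> ?B. \<mu> a * ?H a t)" for t
    proof -
      have "(\<Sum>a \<in> A. ?\<nu> a * G a t) = v * G c t + (\<Sum>a \<in> ?B. ?\<nu> a * G a t)"
        using c insert.prems by (subst sum.remove[of A c]) auto
      also have "(\<Sum>a \<in> ?B. ?\<nu> a * G a t) = (\<Sum>a \<in> ?B. \<mu> a * G a t)"
        by (rule sum.cong) auto
      also have "v * G c t = (\<Sum>a \<in> ?B. - (\<mu> a * (G a s / G c s * G c t)))"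
        by (simp add: v_def sum_negf sum_distrib_right sum_divide_distrib mult.assoc)
      finally show ?thesis
        by (simp add: right_diff_distrib sum_subtractf sum_negf)
    qed
    moreover have "(\<Sum>a \<in> ?B. \<mu> a * ?H a s) = 0" using c by simp
    ultimately show ?thesis
      using a \<mu> by (intro exI[of _ ?\<nu>]) auto
  qed
qed

lemma lookup_single_0_mult:
  "Poly_Mapping.lookup (Poly_Mapping.single 0 c * p) s = c * Poly_Mapping.lookup p s"
  by (simp add: Poly_Mapping.map.rep_eq when_def flip: mult_map_scale_conv_mult)

text \<open>Pigeonhole: a countable type has only countably many finite subsets, so infinitely many
  \<open>G c\<close> share a support \<open>S\<close>. Any \<open>card S + 1\<close> of them are
  vectors in a space of dimension \<open>card S\<close>.\<close>

lemma uncountable_family_linear_relation: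
  fixes G :: "'a \<Rightarrow> ('b::{countable,comm_monoid_add} \<Rightarrow>\<^sub>0 'k::field)"
  assumes "uncountable (UNIV :: 'a set)"
  obtains A \<mu> a where "finite A" "a \<in> A" "\<mu> a \<noteq> 0"
    "(\<Sum>a \<in> A. Poly_Mapping.single 0 (\<mu> a) * G a) = 0"
proof -
  let ?K = "\<lambda>c. Poly_Mapping.keys (G c)"
  have "countable (range ?K)"
    by (rule countable_subset[OF _ countable_Collect_finite]) auto
  then obtain S where S: "infinite {c. ?K c = S}"
  proof -
    have "UNIV = (\<Union>S \<in> range ?K. {c. ?K c = S})" by auto
    then have "\<exists>S. uncountable {c. ?K c = S}"
      using assms \<open>countable (range ?K)\<close> by (metis (no_types, lifting) countable_UN)
    then show ?thesis using that countable_finite by blast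
  qed
  then obtain A where A: "A \<subseteq> {c. ?K c = S}" "finite A" "card A = Suc (card S)"
    using infinite_arbitrarily_large[OF S, of "Suc (card S)"] by blast
  \<comment> \<open>A member of \<open>A\<close> exhibits \<open>S\<close> as the support of some
    \<open>G b\<close>. This gives finiteness of \<open>S\<close>, which \<open>card S\<close> alone
    does not, being 0 for infinite sets.\<close>
  have "A \<noteq> {}" using A(3) by (metis card.empty nat.distinct(1))
  then obtain b where "?K b = S" using A(1) by blast
  then have "finite S" using finite_keys[of "G b"] by simp
  from exists_linear_relation[OF this A(2), of "\<lambda>a. Poly_Mapping.lookup (G a)"] A(3)
  obtain \<mu> a where a: "a \<in> A" "\<mu> a \<noteq> 0"
    and \<mu>: "\<And>s. s \<in> S \<Longrightarrow> (\<Sum>a \<in> A. \<mu> a * Poly_Mapping.lookup (G a) s) = 0"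
    by auto
  have "(\<Sum>a \<in> A. \<mu> a * Poly_Mapping.lookup (G a) s) = 0" for s
  proof (cases "s \<in> S")
    case False
    then have "Poly_Mapping.lookup (G a) s = 0" if "a \<in> A" for a
      using A(1) that by (auto simp: in_keys_iff)
    then show ?thesis by simp
  qed (rule \<mu>)
  then have "(\<Sum>a \<in> A. Poly_Mapping.single 0 (\<mu> a) * G a) = 0"
    by (intro poly_mapping_eqI) (simp add: lookup_sum lookup_single_0_mult)
  with A(2) a show thesis by (rule that)
qed

section \<open>Substitution into univariate polynomials\<close>

lemma poly_map_poly_add:
  assumes "h 0 = 0" "\<And>x y. h (x + y) = h x + h y"
  shows "poly (map_poly h (p + q)) z = poly (map_poly h p) z + poly (map_poly h q) z"
  using assms by (induction p q rule: poly_induct2) (simp_all add: map_poly_pCons algebra_simps)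

lemma poly_map_poly_mult:
  fixes h :: "'a::comm_ring_1 \<Rightarrow> 'b::comm_ring_1"
  assumes "h 0 = 0" "\<And>x y. h (x + y) = h x + h y" "\<And>x y. h (x * y) = h x * h y"
  shows "poly (map_poly h (p * q)) z = poly (map_poly h p) z * poly (map_poly h q) z"
  using assms
  by (induction p)
    (simp_all add: map_poly_pCons map_poly_smult poly_map_poly_add algebra_simps)

abbreviation const :: "'k::field \<Rightarrow> ((rat ^ 'n) \<Rightarrow>\<^sub>0 'k)" where
  "const \<equiv> Poly_Mapping.single 0"

lemma const_mult: "const (a * b) = const a * const b"
  by (simp add: mult_single)

text \<open>Computed in the ambient type, a commutative ring that also has monomials with negative
  exponents; membership in the carrier is tracked separately.\<close>

definition subst_poly :: "'k::field poly \<Rightarrow> ((rat ^ 'n) \<Rightarrow>\<^sub>0 'k) \<Rightarrow> ((rat ^ 'n) \<Rightarrow>\<^sub>0 'k)" where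
  "subst_poly p F = poly (map_poly const p) F"

lemma subst_poly_simps:
  "subst_poly 0 F = 0"
  "subst_poly 1 F = 1"
  "subst_poly [:c:] F = const c"
  "subst_poly [:-c, 1:] F = F - const c"
  by (simp_all add: subst_poly_def map_poly_pCons single_uminus)

lemma subst_poly_add: "subst_poly (p + q) F = subst_poly p F + subst_poly q F"
  unfolding subst_poly_def by (rule poly_map_poly_add) (simp_all add: single_add)

lemma subst_poly_mult: "subst_poly (p * q) F = subst_poly p F * subst_poly q F"
  unfolding subst_poly_def by (rule poly_map_poly_mult) (simp_all add: single_add const_mult)

lemma subst_poly_smult: "subst_poly (smult c p) F = const c * subst_poly p F"
  using subst_poly_mult[of "[:c:]" p F] by (simp add: subst_poly_simps)

lemma subst_poly_sum: "subst_poly (\<Sum>a \<in> A. p a) F = (\<Sum>a \<in> A. subst_poly (p a) F)"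
  by (induction A rule: infinite_finite_induct) (simp_all add: subst_poly_simps subst_poly_add)

lemma subst_poly_prod: "subst_poly (\<Prod>a \<in> A. p a) F = (\<Prod>a \<in> A. subst_poly (p a) F)"
  by (induction A rule: infinite_finite_induct) (simp_all add: subst_poly_simps subst_poly_mult)

section \<open>Arithmetic modulo a maximal ideal\<close>

locale rat_poly_maximalideal =
  fixes M :: "((rat ^ 'n::finite) \<Rightarrow>\<^sub>0 'k::alg_closed_field) set"
  assumes maximal: "maximalideal M rat_poly_ring"
begin

abbreviation "R \<equiv> (rat_poly_ring :: ((rat ^ 'n) \<Rightarrow>\<^sub>0 'k) ring)"

sublocale cring R
  by (rule cring_rat_poly_ring)

sublocale M: maximalideal M R
  by (rule maximal)

lemma ring_ops:
  "x \<oplus>\<^bsub>R\<^esub> y = x + y" "x \<otimes>\<^bsub>R\<^esub> y = x * y" "\<zero>\<^bsub>R\<^esub> = 0" "\<one>\<^bsub>R\<^esub> = 1"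
  by (simp_all add: rat_poly_ring_def)

lemma single_closed: "(\<And>j. 0 \<le> r $ j) \<Longrightarrow> Poly_Mapping.single r c \<in> carrier R"
  by (simp add: rat_poly_ring_def)

lemma const_closed: "const c \<in> carrier R"
  by (simp add: single_closed)

lemma add_closed: "F \<in> carrier R \<Longrightarrow> G \<in> carrier R \<Longrightarrow> F + G \<in> carrier R"
  using a_closed by (simp add: ring_ops)

lemma mult_closed: "F \<in> carrier R \<Longrightarrow> G \<in> carrier R \<Longrightarrow> F * G \<in> carrier R"
  using m_closed by (simp add: ring_ops)

lemma one_mem: "1 \<in> carrier R"
  using one_closed by (simp only: ring_ops)

lemma diff_closed: "F \<in> carrier R \<Longrightarrow> G \<in> carrier R \<Longrightarrow> F - G \<in> carrier R"
  using add_closed[OF _ mult_closed[OF const_closed[of "-1"]], of F G]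
  by (simp add: single_uminus)

lemma M_add: "F \<in> M \<Longrightarrow> G \<in> M \<Longrightarrow> F + G \<in> M"
  using M.a_closed by (simp add: ring_ops)

lemma M_mult: "F \<in> carrier R \<Longrightarrow> G \<in> M \<Longrightarrow> F * G \<in> M"
  using M.I_l_closed by (simp add: ring_ops)

lemma M_uminus: "F \<in> M \<Longrightarrow> - F \<in> M"
  using M_mult[OF const_closed[of "-1"], of F] by (simp add: single_uminus)

lemma M_diff: "F \<in> M \<Longrightarrow> G \<in> M \<Longrightarrow> F - G \<in> M"
  using M_add[OF _ M_uminus, of F G] by simp

lemma M_zero: "0 \<in> M"
  using M.zero_closed by (simp only: ring_ops)

lemma M_sum: "(\<And>a. a \<in> A \<Longrightarrow> F a \<in> M) \<Longrightarrow> (\<Sum>a \<in> A. F a) \<in> M"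
  by (induction A rule: infinite_finite_induct) (auto simp: M_zero M_add)

lemma prod_closed: "(\<And>a. a \<in> A \<Longrightarrow> F a \<in> carrier R) \<Longrightarrow> (\<Prod>a \<in> A. F a) \<in> carrier R"
  by (induction A rule: infinite_finite_induct) (auto simp: one_mem mult_closed)

lemma M_one: "1 \<notin> M"
  using M.one_imp_carrier M.I_notcarr by (auto simp: ring_ops)

text \<open>A nonzero constant is a unit. This later makes residues unique.\<close>

lemma const_in_M_iff: "const c \<in> M \<longleftrightarrow> c = 0"
proof
  assume "const c \<in> M"
  then have "const (inverse c) * const c \<in> M"
    using M_mult const_closed by blast
  then show "c = 0"
    using M_one by (cases "c = 0") (auto simp flip: const_mult)
qed (simp add: M_zero)

lemma M_prime: "F \<in> carrier R \<Longrightarrow> G \<in> carrier R \<Longrightarrow> F * G \<in> M \<Longrightarrow> F \<in> M \<or> G \<in> M"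
  using primeideal.I_prime[OF maximalideal_prime[OF maximal]] by (simp add: ring_ops)

lemma inverse_mod_M:
  assumes "F \<in> carrier R" "F \<notin> M"
  shows "\<exists>G \<in> carrier R. F * G - 1 \<in> M"
proof -
  obtain G m where "G \<in> carrier R" "m \<in> M" "m + G * F = 1"
    using maximalideal_inverse_mod[OF maximal assms] by (auto simp: ring_ops)
  moreover from this have "F * G - 1 = - m"
    by (simp add: mult.commute flip: \<open>m + G * F = 1\<close>)
  ultimately show ?thesis
    using M_uminus[of m] by (intro bexI[of _ G]) simp_all
qed

section \<open>Existence of residues in \<open>k\<close>\<close>

text \<open>Over an algebraically closed field \<open>p\<close> is a product of linear factors.
  Primality of \<open>M\<close> is applied to one factor at a time; the empty product 1 is not in
  \<open>M\<close>.\<close>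

lemma root_mod_M:
  assumes F: "F \<in> carrier R" and "p \<noteq> 0" "subst_poly p F \<in> M"
  shows "\<exists>c. F - const c \<in> M"
proof -
  \<comment> \<open>Primality of \<open>M\<close> concerns only elements of the carrier.\<close>
  have closed: "subst_poly (\<Prod>x\<in>#A. [:-x, 1:]) F \<in> carrier R" for A
    by (induction A)
      (simp_all add: subst_poly_simps subst_poly_mult one_mem mult_closed diff_closed const_closed F
        del: mult_pCons_left)
  have "\<exists>c. F - const c \<in> M" if "subst_poly (\<Prod>x\<in>#A. [:-x, 1:]) F \<in> M" for A
    using that
  proof (induction A)
    case empty
    then show ?case by (simp add: subst_poly_simps M_one)
  next
    case (add x A)
    then have "(F - const x) * subst_poly (\<Prod>x\<in>#A. [:-x, 1:]) F \<in> M"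
      by (simp add: subst_poly_simps subst_poly_mult del: mult_pCons_left)
    then show ?case
      using add.IH M_prime[OF diff_closed[OF F const_closed] closed] by blast
  qed
  moreover obtain A where A: "p = smult (lead_coeff p) (\<Prod>x\<in>#A. [:-x, 1:])"
    using alg_closed_imp_factorization[OF \<open>p \<noteq> 0\<close>] by blast
  have "const (lead_coeff p) * subst_poly (\<Prod>x\<in>#A. [:-x, 1:]) F \<in> M"
    using assms(3) by (subst (asm) A) (simp only: subst_poly_smult)
  then have "subst_poly (\<Prod>x\<in>#A. [:-x, 1:]) F \<in> M"
    using M_prime[OF const_closed closed, of "lead_coeff p" A] \<open>p \<noteq> 0\<close> by (simp add: const_in_M_iff)
  ultimately show ?thesis by blast
qed

text \<open>The inverses of the \<open>F - const c\<close> modulo \<open>M\<close> behave like the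
  fractions 1/(t - c). These are linearly independent in k(t), so a relation between the inverses
  forces an algebraic equation on \<open>F\<close>.\<close>

lemma exists_residue:
  assumes unc: "uncountable (UNIV :: 'k set)" and F: "F \<in> carrier R"
  shows "\<exists>c. F - const c \<in> M"
proof (rule ccontr)
  assume "\<nexists>c. F - const c \<in> M"
  then have "\<forall>c. \<exists>G \<in> carrier R. (F - const c) * G - 1 \<in> M"
    using inverse_mod_M[OF diff_closed[OF F const_closed]] by blast
  then obtain G where G: "\<And>c. G c \<in> carrier R" "\<And>c. (F - const c) * G c - 1 \<in> M"
    by metis
  obtain A \<mu> a where A: "finite A" "a \<in> A" "\<mu> a \<noteq> 0"
    and rel: "(\<Sum>a \<in> A. const (\<mu> a) * G a) = 0"
    by (rule uncountable_family_linear_relation[OF unc, of G])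
  \<comment> \<open>The cofactor of \<open>[:-a, 1:]\<close> in the common denominator;
    \<open>Q a\<close> is its value at \<open>F\<close>.\<close>
  define q where "q = (\<lambda>a. \<Prod>b \<in> A - {a}. [:-b, 1:])"
  define Q where "Q = (\<lambda>a. \<Prod>b \<in> A - {a}. F - const b)"
  define p where "p = (\<Sum>a \<in> A. smult (\<mu> a) (q a))"
  \<comment> \<open>As in Lagrange interpolation, only the summand of index \<open>a\<close>
    survives at the point \<open>a\<close>, so \<open>p\<close> does not vanish there.\<close>
  have "poly (q b) a = 0" if "b \<in> A - {a}" for b
    using A that by (auto simp: q_def poly_prod)
  then have "poly p a = \<mu> a * poly (q a) a"
    using A by (simp add: p_def poly_sum sum.remove[of A a])
  also have "\<dots> \<noteq> 0"
    using A by (auto simp: q_def poly_prod)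
  finally have "p \<noteq> 0" by auto
  have Q_closed: "Q a \<in> carrier R" for a
    unfolding Q_def by (intro prod_closed diff_closed F const_closed)
  \<comment> \<open>Clearing denominators in the relation between the inverses \<open>G a\<close> of \<open>F - a\<close>.\<close>
  have "subst_poly p F = (\<Sum>a \<in> A. const (\<mu> a) * Q a)"
    by (simp add: p_def q_def Q_def subst_poly_sum subst_poly_smult subst_poly_prod subst_poly_simps)
  also have "\<dots> = (\<Prod>b \<in> A. F - const b) * (\<Sum>a \<in> A. const (\<mu> a) * G a)
      - (\<Sum>a \<in> A. const (\<mu> a) * Q a * ((F - const a) * G a - 1))"
  proof -
    have "const (\<mu> a) * Q a = (\<Prod>b \<in> A. F - const b) * (const (\<mu> a) * G a)
        - const (\<mu> a) * Q a * ((F - const a) * G a - 1)" if "a \<in> A" for a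
    proof -
      have P: "(\<Prod>b \<in> A. F - const b) = (F - const a) * Q a"
        unfolding Q_def using A(1) that by (rule prod.remove)
      show ?thesis
        unfolding P by (simp add: algebra_simps)
    qed
    then show ?thesis
      unfolding sum_distrib_left sum_subtractf[symmetric] by (rule sum.cong[OF refl])
  qed
  \<comment> \<open>The first product is zero by \<open>rel\<close>; every summand of the second sum
    is a multiple of some \<open>(F - const a) * G a - 1\<close>.\<close>
  also have "\<dots> \<in> M"
    unfolding rel by (simp add: M_uminus M_sum M_mult mult_closed const_closed Q_closed G)
  finally show False
    using root_mod_M[OF F \<open>p \<noteq> 0\<close>] \<open>\<nexists>c. F - const c \<in> M\<close> by blast
qed

section \<open>The residue map to \<open>k\<close>\<close>

definition residue :: "((rat ^ 'n) \<Rightarrow>\<^sub>0 'k) \<Rightarrow> 'k" where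
  "residue F = (SOME c. F - const c \<in> M)"

text \<open>Two constants congruent to \<open>F\<close> differ by a constant in \<open>M\<close>,
  which is 0.\<close>

lemma residue_eqI:
  assumes "F - const c \<in> M"
  shows "residue F = c"
proof -
  have "F - const (residue F) \<in> M"
    unfolding residue_def using assms by (rule someI)
  then have "const (residue F - c) \<in> M"
    using M_diff[OF assms, of "F - const (residue F)"] by (simp add: single_diff)
  then show ?thesis by (simp add: const_in_M_iff)
qed

lemma residue_mem: "F \<in> M \<Longrightarrow> residue F = 0"
  by (rule residue_eqI) simp

lemma residue_const: "residue (const c) = c"
  by (rule residue_eqI) (simp add: M_zero)

lemma residue_one: "residue 1 = 1"
  using residue_const[of 1] by simp

context
  assumes unc: "uncountable (UNIV :: 'k set)"
begin

lemma residue_diff: "F \<in> carrier R \<Longrightarrow> F - const (residue F) \<in> M"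
  unfolding residue_def by (rule someI_ex) (rule exists_residue[OF unc])

lemma residue_add:
  assumes "F \<in> carrier R" "G \<in> carrier R"
  shows "residue (F + G) = residue F + residue G"
  using M_add[OF assms[THEN residue_diff]]
  by (intro residue_eqI) (simp add: single_add algebra_simps)

lemma residue_mult:
  assumes "F \<in> carrier R" "G \<in> carrier R"
  shows "residue (F * G) = residue F * residue G"
proof (rule residue_eqI)
  have "F * G - const (residue F * residue G)
      = F * (G - const (residue G)) + const (residue G) * (F - const (residue F))"
    by (simp add: const_mult algebra_simps)
  also have "\<dots> \<in> M"
    using assms by (intro M_add M_mult residue_diff const_closed)
  finally show "F * G - const (residue F * residue G) \<in> M" .
qed

lemma power_closed: "F \<in> carrier R \<Longrightarrow> F ^ m \<in> carrier R"
  by (induction m) (auto simp: one_mem mult_closed)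

lemma residue_power: "F \<in> carrier R \<Longrightarrow> residue (F ^ m) = residue F ^ m"
  by (induction m) (simp_all add: residue_one residue_mult power_closed)

lemma residue_prod:
  "(\<And>a. a \<in> A \<Longrightarrow> F a \<in> carrier R) \<Longrightarrow> residue (\<Prod>a \<in> A. F a) = (\<Prod>a \<in> A. residue (F a))"
  by (induction A rule: infinite_finite_induct)
    (simp_all add: residue_one residue_mult prod_closed)

lemma sum_closed: "(\<And>a. a \<in> A \<Longrightarrow> F a \<in> carrier R) \<Longrightarrow> (\<Sum>a \<in> A. F a) \<in> carrier R"
  using M_zero M.Icarr by (induction A rule: infinite_finite_induct) (auto simp: add_closed)

lemma residue_sum:
  "(\<And>a. a \<in> A \<Longrightarrow> F a \<in> carrier R) \<Longrightarrow> residue (\<Sum>a \<in> A. F a) = (\<Sum>a \<in> A. residue (F a))"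
  by (induction A rule: infinite_finite_induct)
    (simp_all add: residue_mem M_zero residue_add sum_closed)

section \<open>Compatible roots from residues\<close>

text \<open>The image of \<open>T_j^(1/i)\<close> in the residue field \<open>k\<close>.\<close>

definition residue_root :: "'n \<Rightarrow> nat \<Rightarrow> 'k" where
  "residue_root j i = residue (Poly_Mapping.single (axis j (1 / of_nat i)) 1)"

lemma single_axis_power:
  "Poly_Mapping.single (axis j q :: rat ^ 'n) (1::'k) ^ m = Poly_Mapping.single (axis j (of_nat m * q)) 1"
proof (induction m)
  case 0
  have "axis j 0 = (0 :: rat ^ 'n)" by (simp add: vec_eq_iff axis_def)
  then show ?case by (simp only: of_nat_0 mult_zero_left power_0 single_one)
next
  case (Suc m)
  have "axis j q + axis j (of_nat m * q) = (axis j (of_nat (Suc m) * q) :: rat ^ 'n)"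
    by (simp add: vec_eq_iff axis_def algebra_simps)
  then show ?case using Suc by (simp add: mult_single)
qed

lemma axis_closed: "0 \<le> q \<Longrightarrow> Poly_Mapping.single (axis j q) c \<in> carrier R"
  by (rule single_closed) (simp add: axis_def)

text \<open>Residues are multiplicative. The case \<open>i = 0\<close> fits, because division by 0
  yields 0 in both exponents.\<close>

lemma residue_root_power:
  "residue_root j i ^ m = residue (Poly_Mapping.single (axis j (of_nat m / of_nat i)) 1)"
  by (simp add: residue_root_def axis_closed single_axis_power flip: residue_power)

text \<open>The l-th power of \<open>T_j^(1/(il))\<close> is \<open>T_j^(1/i)\<close>, and residues
  preserve this. The point has the residues of the \<open>T_j\<close> as coordinates.\<close>

lemma compatible_residue_roots: "compatible_roots (\<chi> j. residue_root j 1) residue_root"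
  by (auto simp: compatible_roots_def residue_root_power) (simp add: residue_root_def)

text \<open>For \<open>q\<close> nonnegative the numerator in lowest terms is a natural number, so
  \<open>residue_root_power\<close> applies.\<close>

lemma root_power_residue_root:
  assumes "0 \<le> q"
  shows "root_power (residue_root j) q = residue (Poly_Mapping.single (axis j q) 1)"
proof -
  obtain a b where ab: "quotient_of q = (a, b)" by fastforce
  have b: "b > 0" and q: "q = of_int a / of_int b"
    using quotient_of_denom_pos[OF ab] quotient_of_div[OF ab] by auto
  have "a \<ge> 0" using assms b by (simp add: q zero_le_divide_iff)
  then have "of_nat (nat a) / of_nat (nat b) = q" using b q by simp
  then show ?thesis by (simp add: root_power_def ab residue_root_power)
qed

lemma single_eq_const_mult_prod:
  fixes r :: "rat ^ 'n"
  shows "Poly_Mapping.single r (c::'k) = const c * (\<Prod>j \<in> UNIV. Poly_Mapping.single (axis j (r $ j)) 1)"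
proof -
  have sum_axis: "(\<Sum>j \<in> UNIV. axis j (r $ j)) = r"
    by (simp add: vec_eq_iff axis_def)
  have "(\<Prod>j \<in> J. Poly_Mapping.single (f j) (1::'k)) = Poly_Mapping.single (\<Sum>j \<in> J. f j) 1"
    for f :: "'n \<Rightarrow> rat ^ 'n" and J
    by (induction J rule: infinite_finite_induct) (simp_all add: mult_single)
  from this[of "\<lambda>j. axis j (r $ j)" UNIV] show ?thesis
    by (simp add: mult_single sum_axis)
qed

text \<open>Residues respect sums, products and constants, so it suffices to split \<open>F\<close>
  into terms and each term into powers of single variables.\<close>

lemma eval_residue_root:
  assumes "F \<in> carrier R"
  shows "eval_rat_poly residue_root F = residue F"
proof -
  let ?X = "\<lambda>r. Poly_Mapping.single r (Poly_Mapping.lookup F r)"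
  have pos: "0 \<le> r $ j" if "r \<in> Poly_Mapping.keys F" for r j
    using assms that by (simp add: rat_poly_ring_def)
  have "F = (\<Sum>r \<in> Poly_Mapping.keys F. ?X r)"
    by (rule poly_mapping_eqI) (simp add: lookup_sum lookup_single when_def in_keys_iff)
  then have "residue F = (\<Sum>r \<in> Poly_Mapping.keys F. residue (?X r))"
    using residue_sum[of "Poly_Mapping.keys F" ?X] pos single_closed by simp
  also have "\<dots> = eval_rat_poly residue_root F"
    unfolding eval_rat_poly_def
  proof (rule sum.cong)
    fix r assume "r \<in> Poly_Mapping.keys F"
    then show "residue (?X r) = Poly_Mapping.lookup F r * (\<Prod>j \<in> UNIV. root_power (residue_root j) (r $ j))"
      by (subst single_eq_const_mult_prod)
        (simp add: residue_mult residue_prod residue_const const_closed prod_closed axis_closed pos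
          root_power_residue_root)
  qed simp
  finally show ?thesis by simp
qed

lemma zero_locus_nonempty: "zero_locus M \<noteq> {}"
proof -
  have "eval_rat_poly residue_root F = 0" if "F \<in> M" for F
    using that by (simp add: eval_residue_root residue_mem M.Icarr)
  then show ?thesis
    using compatible_residue_roots unfolding zero_locus_def by blast
qed

end

end

theorem mainTheorem3:
  fixes I :: "((rat ^ 'n::finite) \<Rightarrow>\<^sub>0 'k::alg_closed_field) set"
  assumes "uncountable (UNIV :: 'k set)"
    and "ideal I rat_poly_ring"
    and "I \<noteq> carrier rat_poly_ring"
  shows "zero_locus I \<noteq> {}"
proof -
  obtain M where M: "maximalideal M rat_poly_ring" "I \<subseteq> M"
    by (rule cring.proper_ideal_subset_maximalideal[OF cring_rat_poly_ring assms(2,3)])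
  then have "zero_locus M \<noteq> {}"
    by (intro rat_poly_maximalideal.zero_locus_nonempty rat_poly_maximalideal.intro assms(1))
  then show ?thesis
    \<comment> \<open>A zero of \<open>M\<close>, with the same roots, is a zero of the smaller
      ideal \<open>I\<close>.\<close>
    using M(2) by (auto simp: zero_locus_def)
qed

end
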